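(* Let $G$ be a (possibly infinite) group, let $H \leq G$ be a cyclic subgroup, and let $R$ be a commutative ring. Then $$\mathrm{N}_{\mathrm{U}(RG)}(H) = \mathrm{N}_G(H)\cdot \mathrm{C}_{\mathrm{U}(RG)}(H).$$
   Context: Rings have an identity element $1$, and $R \neq 0$. $RG$ is the group ring of $G$ over $R$ and $\mathrm{U}(RG)$ its group of units; $G$ is regarded as a subgroup of $\mathrm{U}(RG)$. For a group $X$ and a subgroup $H \leq X$ (or a supergroup $X$ of $H$), $\mathrm{N}_X(H)=\{x\in X : x^{-1}Hx=H\}$ is the normalizer and $\mathrm{C}_X(H)$ the centralizer of $H$ in $X$. Cyclic groups may be finite or infinite. *)

theory Defs
  imports "HOL-Algebra.Algebra"
begin

text \<open>
  Elements of the group ring are finitely supported coefficient functions on \<open>carrier G\<close>,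
  extended by \<^const>\<open>undefined\<close> outside of it. Multiplication is convolution: the \<open>x\<close>-coefficient
  is the sum of \<open>a y \<otimes> b z\<close> over all factorisations \<open>x = y \<otimes> z\<close>, indexed here by those \<open>y\<close> in the
  (finite) support of \<open>a\<close>, since \<^const>\<open>finsum\<close> is only meaningful on finite index sets.
\<close>

definition group_ring ::
  "('r, 'n) ring_scheme \<Rightarrow> ('g, 'm) monoid_scheme \<Rightarrow> ('g \<Rightarrow> 'r) ring"
  where "group_ring R G =
    \<lparr>carrier = {a \<in> carrier G \<rightarrow>\<^sub>E carrier R. finite {g \<in> carrier G. a g \<noteq> \<zero>\<^bsub>R\<^esub>}},
     monoid.mult = (\<lambda>a b. \<lambda>x\<in>carrier G.
       \<Oplus>\<^bsub>R\<^esub>y\<in>{y \<in> carrier G. a y \<noteq> \<zero>\<^bsub>R\<^esub>}. a y \<otimes>\<^bsub>R\<^esub> b (inv\<^bsub>G\<^esub> y \<otimes>\<^bsub>G\<^esub> x)),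
     one = (\<lambda>x\<in>carrier G. if x = \<one>\<^bsub>G\<^esub> then \<one>\<^bsub>R\<^esub> else \<zero>\<^bsub>R\<^esub>),
     ring.zero = (\<lambda>x\<in>carrier G. \<zero>\<^bsub>R\<^esub>),
     ring.add = (\<lambda>a b. \<lambda>x\<in>carrier G. a x \<oplus>\<^bsub>R\<^esub> b x)\<rparr>"

text \<open>The embedding along which \<open>G\<close> is regarded as a subgroup of the unit group of \<open>RG\<close>.\<close>

definition group_ring_emb ::
  "('r, 'n) ring_scheme \<Rightarrow> ('g, 'm) monoid_scheme \<Rightarrow> 'g \<Rightarrow> ('g \<Rightarrow> 'r)"
  where "group_ring_emb R G g = (\<lambda>x\<in>carrier G. if x = g then \<one>\<^bsub>R\<^esub> else \<zero>\<^bsub>R\<^esub>)"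

definition centralizer :: "('a, 'm) monoid_scheme \<Rightarrow> 'a set \<Rightarrow> 'a set"
  where "centralizer G H = {x \<in> carrier G. \<forall>h\<in>H. x \<otimes>\<^bsub>G\<^esub> h = h \<otimes>\<^bsub>G\<^esub> x}"

lemma group_ring_simps:
  "a \<in> carrier (group_ring R G) \<longleftrightarrow>
     a \<in> carrier G \<rightarrow>\<^sub>E carrier R \<and> finite {g \<in> carrier G. a g \<noteq> \<zero>\<^bsub>R\<^esub>}"
  "\<one>\<^bsub>group_ring R G\<^esub> = group_ring_emb R G \<one>\<^bsub>G\<^esub>"
  "\<zero>\<^bsub>group_ring R G\<^esub> = (\<lambda>x\<in>carrier G. \<zero>\<^bsub>R\<^esub>)"
  "a \<oplus>\<^bsub>group_ring R G\<^esub> b = (\<lambda>x\<in>carrier G. a x \<oplus>\<^bsub>R\<^esub> b x)"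
  by (auto simp: group_ring_def group_ring_emb_def)

locale group_ring_setting = G: group G + R: cring R
  for G :: "('g, 'm) monoid_scheme" and R :: "('r, 'n) ring_scheme"
begin

declare group_ring_simps [simp]

abbreviation "RG \<equiv> group_ring R G"
abbreviation "supp a \<equiv> {g \<in> carrier G. a g \<noteq> \<zero>\<^bsub>R\<^esub>}"
abbreviation "emb \<equiv> group_ring_emb R G"

lemma in_R: "a \<in> carrier RG \<Longrightarrow> x \<in> carrier G \<Longrightarrow> a x \<in> carrier R"
  by auto

lemma mult_apply:
  assumes "a \<in> carrier RG" "b \<in> carrier RG" "finite S" "supp a \<subseteq> S" "S \<subseteq> carrier G" "x \<in> carrier G"
  shows "(a \<otimes>\<^bsub>RG\<^esub> b) x = (\<Oplus>\<^bsub>R\<^esub>y\<in>S. a y \<otimes>\<^bsub>R\<^esub> b (inv\<^bsub>G\<^esub> y \<otimes>\<^bsub>G\<^esub> x))"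
proof -
  have c: "b (inv\<^bsub>G\<^esub> y \<otimes>\<^bsub>G\<^esub> x) \<in> carrier R" if "y \<in> carrier G" for y
    using in_R[OF assms(2)] assms(6) that by auto
  have c': "a y \<in> carrier R" if "y \<in> carrier G" for y
    using in_R[OF assms(1)] that by auto
  have "(\<Oplus>\<^bsub>R\<^esub>y\<in>supp a. a y \<otimes>\<^bsub>R\<^esub> b (inv\<^bsub>G\<^esub> y \<otimes>\<^bsub>G\<^esub> x)) = (\<Oplus>\<^bsub>R\<^esub>y\<in>S. a y \<otimes>\<^bsub>R\<^esub> b (inv\<^bsub>G\<^esub> y \<otimes>\<^bsub>G\<^esub> x))"
  proof (rule R.add.finprod_mono_neutral_cong_left)
    show "a i \<otimes>\<^bsub>R\<^esub> b (inv\<^bsub>G\<^esub> i \<otimes>\<^bsub>G\<^esub> x) = \<zero>\<^bsub>R\<^esub>" if "i \<in> S - supp a" for i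
    proof -
      have "i \<in> carrier G" "a i = \<zero>\<^bsub>R\<^esub>" using that assms(5) by auto
      then show ?thesis using c by simp
    qed
    show "(\<lambda>y. a y \<otimes>\<^bsub>R\<^esub> b (inv\<^bsub>G\<^esub> y \<otimes>\<^bsub>G\<^esub> x)) \<in> S \<rightarrow> carrier R"
      using c c' assms(5) by auto
  qed (use assms in blast)+
  then show ?thesis using assms(6) by (simp add: group_ring_def)
qed

lemma finsum_swap:
  assumes "finite A" "finite B" "\<And>x y. x \<in> A \<Longrightarrow> y \<in> B \<Longrightarrow> f x y \<in> carrier R"
  shows "(\<Oplus>\<^bsub>R\<^esub>x\<in>A. \<Oplus>\<^bsub>R\<^esub>y\<in>B. f x y) = (\<Oplus>\<^bsub>R\<^esub>y\<in>B. \<Oplus>\<^bsub>R\<^esub>x\<in>A. f x y)"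
  using assms(1,3)
proof (induction A)
  case empty then show ?case by simp
next
  case (insert x A)
  have "(\<Oplus>\<^bsub>R\<^esub>x\<in>insert x A. \<Oplus>\<^bsub>R\<^esub>y\<in>B. f x y) = (\<Oplus>\<^bsub>R\<^esub>y\<in>B. f x y) \<oplus>\<^bsub>R\<^esub> (\<Oplus>\<^bsub>R\<^esub>x\<in>A. \<Oplus>\<^bsub>R\<^esub>y\<in>B. f x y)"
    using insert by (intro R.finsum_insert) auto
  also have "\<dots> = (\<Oplus>\<^bsub>R\<^esub>y\<in>B. f x y) \<oplus>\<^bsub>R\<^esub> (\<Oplus>\<^bsub>R\<^esub>y\<in>B. \<Oplus>\<^bsub>R\<^esub>x\<in>A. f x y)"
    using insert by simp
  also have "\<dots> = (\<Oplus>\<^bsub>R\<^esub>y\<in>B. f x y \<oplus>\<^bsub>R\<^esub> (\<Oplus>\<^bsub>R\<^esub>x\<in>A. f x y))"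
    using insert.prems by (intro R.finsum_addf[symmetric]) auto
  also have "\<dots> = (\<Oplus>\<^bsub>R\<^esub>y\<in>B. \<Oplus>\<^bsub>R\<^esub>x\<in>insert x A. f x y)"
    using insert by (intro R.finsum_cong' refl) (auto intro!: R.finsum_insert[symmetric])
  finally show ?case .
qed

lemma zero_outside:
  assumes "x \<in> carrier G" "x \<notin> supp a" shows "a x = \<zero>\<^bsub>R\<^esub>"
  using assms by auto

lemma supp_mult:
  assumes "a \<in> carrier RG" "b \<in> carrier RG"
  shows "supp (a \<otimes>\<^bsub>RG\<^esub> b) \<subseteq> (\<lambda>(y, z). y \<otimes>\<^bsub>G\<^esub> z) ` (supp a \<times> supp b)"
proof
  fix x assume x: "x \<in> supp (a \<otimes>\<^bsub>RG\<^esub> b)"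
  have ex: "\<exists>y\<in>supp a. b (inv\<^bsub>G\<^esub> y \<otimes>\<^bsub>G\<^esub> x) \<noteq> \<zero>\<^bsub>R\<^esub>"
  proof (rule ccontr)
    assume *: "\<not> ?thesis"
    have "(\<Oplus>\<^bsub>R\<^esub>y\<in>supp a. a y \<otimes>\<^bsub>R\<^esub> b (inv\<^bsub>G\<^esub> y \<otimes>\<^bsub>G\<^esub> x)) = \<zero>\<^bsub>R\<^esub>"
      using * in_R[OF assms(1)] by (intro R.add.finprod_one_eqI) auto
    then show False using x by (auto simp: group_ring_def)
  qed
  then obtain y where y: "y \<in> supp a" "b (inv\<^bsub>G\<^esub> y \<otimes>\<^bsub>G\<^esub> x) \<noteq> \<zero>\<^bsub>R\<^esub>" by blast
  then have "x = y \<otimes>\<^bsub>G\<^esub> (inv\<^bsub>G\<^esub> y \<otimes>\<^bsub>G\<^esub> x)" "inv\<^bsub>G\<^esub> y \<otimes>\<^bsub>G\<^esub> x \<in> supp b"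
    using x by (auto simp: G.m_assoc[symmetric])
  then show "x \<in> (\<lambda>(y, z). y \<otimes>\<^bsub>G\<^esub> z) ` (supp a \<times> supp b)"
    using y(1) by (intro image_eqI[where x = "(y, inv\<^bsub>G\<^esub> y \<otimes>\<^bsub>G\<^esub> x)"]) auto
qed

lemma mult_closed:
  assumes "a \<in> carrier RG" "b \<in> carrier RG" shows "a \<otimes>\<^bsub>RG\<^esub> b \<in> carrier RG"
proof -
  have "finite (supp (a \<otimes>\<^bsub>RG\<^esub> b))"
    by (rule finite_subset[OF supp_mult[OF assms]]) (use assms in auto)
  moreover have "a \<otimes>\<^bsub>RG\<^esub> b \<in> carrier G \<rightarrow>\<^sub>E carrier R"
    using assms in_R[OF assms(2)] by (auto simp: group_ring_def intro!: R.finsum_closed R.m_closed)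
  ultimately show ?thesis by simp
qed

lemma mult_ext: "x \<notin> carrier G \<Longrightarrow> (a \<otimes>\<^bsub>RG\<^esub> b) x = undefined"
  by (simp add: group_ring_def)

lemma mult_assoc:
  assumes abc: "a \<in> carrier RG" "b \<in> carrier RG" "c \<in> carrier RG"
  shows "(a \<otimes>\<^bsub>RG\<^esub> b) \<otimes>\<^bsub>RG\<^esub> c = a \<otimes>\<^bsub>RG\<^esub> (b \<otimes>\<^bsub>RG\<^esub> c)"
proof
  fix x
  show "((a \<otimes>\<^bsub>RG\<^esub> b) \<otimes>\<^bsub>RG\<^esub> c) x = (a \<otimes>\<^bsub>RG\<^esub> (b \<otimes>\<^bsub>RG\<^esub> c)) x"
  proof (cases "x \<in> carrier G")
    case x: True
    define S where "S = (\<lambda>(y, z). y \<otimes>\<^bsub>G\<^esub> z) ` (supp a \<times> supp b)"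
    have S: "finite S" "S \<subseteq> carrier G" "supp (a \<otimes>\<^bsub>RG\<^esub> b) \<subseteq> S"
      using abc supp_mult[OF abc(1,2)] by (auto simp: S_def)
    note ca = in_R[OF abc(1)] and cb = in_R[OF abc(2)] and cc = in_R[OF abc(3)]
    have sm: "s \<in> carrier G" if "s \<in> S" for s using S that by auto
    have fa: "finite (supp a)" and fb: "finite (supp b)" using abc by auto
    have "((a \<otimes>\<^bsub>RG\<^esub> b) \<otimes>\<^bsub>RG\<^esub> c) x
        = (\<Oplus>\<^bsub>R\<^esub>z\<in>S. (a \<otimes>\<^bsub>RG\<^esub> b) z \<otimes>\<^bsub>R\<^esub> c (inv\<^bsub>G\<^esub> z \<otimes>\<^bsub>G\<^esub> x))"
      using mult_apply[OF mult_closed[OF abc(1,2)] abc(3) S(1,3,2) x] .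
    also have "\<dots> = (\<Oplus>\<^bsub>R\<^esub>z\<in>S. \<Oplus>\<^bsub>R\<^esub>y\<in>supp a. a y \<otimes>\<^bsub>R\<^esub> b (inv\<^bsub>G\<^esub> y \<otimes>\<^bsub>G\<^esub> z) \<otimes>\<^bsub>R\<^esub> c (inv\<^bsub>G\<^esub> z \<otimes>\<^bsub>G\<^esub> x))"
    proof (intro R.finsum_cong' refl)
      fix z assume z: "z \<in> S"
      have "(a \<otimes>\<^bsub>RG\<^esub> b) z = (\<Oplus>\<^bsub>R\<^esub>y\<in>supp a. a y \<otimes>\<^bsub>R\<^esub> b (inv\<^bsub>G\<^esub> y \<otimes>\<^bsub>G\<^esub> z))"
        by (rule mult_apply[OF abc(1,2) fa]) (use sm z in auto)
      then show "(a \<otimes>\<^bsub>RG\<^esub> b) z \<otimes>\<^bsub>R\<^esub> c (inv\<^bsub>G\<^esub> z \<otimes>\<^bsub>G\<^esub> x) =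
        (\<Oplus>\<^bsub>R\<^esub>y\<in>supp a. a y \<otimes>\<^bsub>R\<^esub> b (inv\<^bsub>G\<^esub> y \<otimes>\<^bsub>G\<^esub> z) \<otimes>\<^bsub>R\<^esub> c (inv\<^bsub>G\<^esub> z \<otimes>\<^bsub>G\<^esub> x))"
        using sm[OF z] x fa ca cb cc by (simp add: R.finsum_ldistr Pi_iff)
    qed (use sm x ca cb cc in \<open>auto intro!: R.finsum_closed R.m_closed\<close>)
    also have "\<dots> = (\<Oplus>\<^bsub>R\<^esub>y\<in>supp a. \<Oplus>\<^bsub>R\<^esub>z\<in>S. a y \<otimes>\<^bsub>R\<^esub> b (inv\<^bsub>G\<^esub> y \<otimes>\<^bsub>G\<^esub> z) \<otimes>\<^bsub>R\<^esub> c (inv\<^bsub>G\<^esub> z \<otimes>\<^bsub>G\<^esub> x))"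
      by (rule finsum_swap) (use S(1) fa sm x ca cb cc in \<open>auto intro!: R.m_closed\<close>)
    also have "\<dots> = (\<Oplus>\<^bsub>R\<^esub>y\<in>supp a. a y \<otimes>\<^bsub>R\<^esub> (b \<otimes>\<^bsub>RG\<^esub> c) (inv\<^bsub>G\<^esub> y \<otimes>\<^bsub>G\<^esub> x))"
    proof (intro R.finsum_cong' refl)
      fix y assume y: "y \<in> supp a"
      then have yG: "y \<in> carrier G" by simp
      let ?T = "(\<lambda>z. inv\<^bsub>G\<^esub> y \<otimes>\<^bsub>G\<^esub> z) ` S"
      have inj: "inj_on (\<lambda>z. inv\<^bsub>G\<^esub> y \<otimes>\<^bsub>G\<^esub> z) S"
        using yG sm by (auto intro!: inj_onI)
      have sub: "supp b \<subseteq> ?T"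
      proof
        fix w assume w: "w \<in> supp b"
        then have "w = inv\<^bsub>G\<^esub> y \<otimes>\<^bsub>G\<^esub> (y \<otimes>\<^bsub>G\<^esub> w)" using yG by (simp add: G.m_assoc[symmetric])
        moreover have "y \<otimes>\<^bsub>G\<^esub> w \<in> S" using y w by (auto simp: S_def)
        ultimately show "w \<in> ?T" by blast
      qed
      have xin: "inv\<^bsub>G\<^esub> y \<otimes>\<^bsub>G\<^esub> x \<in> carrier G" using yG x by simp
      have "(b \<otimes>\<^bsub>RG\<^esub> c) (inv\<^bsub>G\<^esub> y \<otimes>\<^bsub>G\<^esub> x)
          = (\<Oplus>\<^bsub>R\<^esub>w\<in>?T. b w \<otimes>\<^bsub>R\<^esub> c (inv\<^bsub>G\<^esub> w \<otimes>\<^bsub>G\<^esub> (inv\<^bsub>G\<^esub> y \<otimes>\<^bsub>G\<^esub> x)))"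
        by (rule mult_apply[OF abc(2,3) _ sub _ xin]) (use S yG sm in auto)
      also have "\<dots> = (\<Oplus>\<^bsub>R\<^esub>z\<in>S. b (inv\<^bsub>G\<^esub> y \<otimes>\<^bsub>G\<^esub> z) \<otimes>\<^bsub>R\<^esub> c (inv\<^bsub>G\<^esub> (inv\<^bsub>G\<^esub> y \<otimes>\<^bsub>G\<^esub> z) \<otimes>\<^bsub>G\<^esub> (inv\<^bsub>G\<^esub> y \<otimes>\<^bsub>G\<^esub> x)))"
        by (rule R.finsum_reindex[OF _ inj]) (use yG sm x cb cc in \<open>auto intro!: R.m_closed\<close>)
      also have "\<dots> = (\<Oplus>\<^bsub>R\<^esub>z\<in>S. b (inv\<^bsub>G\<^esub> y \<otimes>\<^bsub>G\<^esub> z) \<otimes>\<^bsub>R\<^esub> c (inv\<^bsub>G\<^esub> z \<otimes>\<^bsub>G\<^esub> x))"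
      proof (intro R.finsum_cong' refl)
        fix z assume z: "z \<in> S"
        have "y \<otimes>\<^bsub>G\<^esub> (inv\<^bsub>G\<^esub> y \<otimes>\<^bsub>G\<^esub> x) = x" using yG x G.m_assoc[of y "inv\<^bsub>G\<^esub> y" x] by simp
        then have "inv\<^bsub>G\<^esub> (inv\<^bsub>G\<^esub> y \<otimes>\<^bsub>G\<^esub> z) \<otimes>\<^bsub>G\<^esub> (inv\<^bsub>G\<^esub> y \<otimes>\<^bsub>G\<^esub> x) = inv\<^bsub>G\<^esub> z \<otimes>\<^bsub>G\<^esub> x"
          using yG sm[OF z] x by (simp add: G.inv_mult_group G.m_assoc)
        then show "b (inv\<^bsub>G\<^esub> y \<otimes>\<^bsub>G\<^esub> z) \<otimes>\<^bsub>R\<^esub> c (inv\<^bsub>G\<^esub> (inv\<^bsub>G\<^esub> y \<otimes>\<^bsub>G\<^esub> z) \<otimes>\<^bsub>G\<^esub> (inv\<^bsub>G\<^esub> y \<otimes>\<^bsub>G\<^esub> x))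
          = b (inv\<^bsub>G\<^esub> y \<otimes>\<^bsub>G\<^esub> z) \<otimes>\<^bsub>R\<^esub> c (inv\<^bsub>G\<^esub> z \<otimes>\<^bsub>G\<^esub> x)" by simp
      qed (use yG sm x cb cc in \<open>auto intro!: R.m_closed\<close>)
      finally have e: "(b \<otimes>\<^bsub>RG\<^esub> c) (inv\<^bsub>G\<^esub> y \<otimes>\<^bsub>G\<^esub> x) = (\<Oplus>\<^bsub>R\<^esub>z\<in>S. b (inv\<^bsub>G\<^esub> y \<otimes>\<^bsub>G\<^esub> z) \<otimes>\<^bsub>R\<^esub> c (inv\<^bsub>G\<^esub> z \<otimes>\<^bsub>G\<^esub> x))" .
      have "a y \<otimes>\<^bsub>R\<^esub> (\<Oplus>\<^bsub>R\<^esub>z\<in>S. b (inv\<^bsub>G\<^esub> y \<otimes>\<^bsub>G\<^esub> z) \<otimes>\<^bsub>R\<^esub> c (inv\<^bsub>G\<^esub> z \<otimes>\<^bsub>G\<^esub> x)) =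
        (\<Oplus>\<^bsub>R\<^esub>z\<in>S. a y \<otimes>\<^bsub>R\<^esub> (b (inv\<^bsub>G\<^esub> y \<otimes>\<^bsub>G\<^esub> z) \<otimes>\<^bsub>R\<^esub> c (inv\<^bsub>G\<^esub> z \<otimes>\<^bsub>G\<^esub> x)))"
        by (rule R.finsum_rdistr) (use S yG sm x ca cb cc in \<open>auto intro!: R.m_closed\<close>)
      also have "\<dots> = (\<Oplus>\<^bsub>R\<^esub>z\<in>S. a y \<otimes>\<^bsub>R\<^esub> b (inv\<^bsub>G\<^esub> y \<otimes>\<^bsub>G\<^esub> z) \<otimes>\<^bsub>R\<^esub> c (inv\<^bsub>G\<^esub> z \<otimes>\<^bsub>G\<^esub> x))"
      proof (intro R.finsum_cong' refl)
        fix z assume z: "z \<in> S"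
        show "a y \<otimes>\<^bsub>R\<^esub> (b (inv\<^bsub>G\<^esub> y \<otimes>\<^bsub>G\<^esub> z) \<otimes>\<^bsub>R\<^esub> c (inv\<^bsub>G\<^esub> z \<otimes>\<^bsub>G\<^esub> x)) = a y \<otimes>\<^bsub>R\<^esub> b (inv\<^bsub>G\<^esub> y \<otimes>\<^bsub>G\<^esub> z) \<otimes>\<^bsub>R\<^esub> c (inv\<^bsub>G\<^esub> z \<otimes>\<^bsub>G\<^esub> x)"
          by (rule R.m_assoc[symmetric]) (use yG sm[OF z] x ca cb cc in auto)
      qed (use yG sm x ca cb cc in \<open>auto intro!: R.m_closed\<close>)
      finally show "(\<Oplus>\<^bsub>R\<^esub>z\<in>S. a y \<otimes>\<^bsub>R\<^esub> b (inv\<^bsub>G\<^esub> y \<otimes>\<^bsub>G\<^esub> z) \<otimes>\<^bsub>R\<^esub> c (inv\<^bsub>G\<^esub> z \<otimes>\<^bsub>G\<^esub> x)) = a y \<otimes>\<^bsub>R\<^esub> (b \<otimes>\<^bsub>RG\<^esub> c) (inv\<^bsub>G\<^esub> y \<otimes>\<^bsub>G\<^esub> x)"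
        using e by simp
    qed (use x ca in_R[OF mult_closed[OF abc(2,3)]] in \<open>auto intro!: R.m_closed\<close>)
    also have "\<dots> = (a \<otimes>\<^bsub>RG\<^esub> (b \<otimes>\<^bsub>RG\<^esub> c)) x"
      by (rule mult_apply[OF abc(1) mult_closed[OF abc(2,3)] fa _ _ x, symmetric]) auto
    finally show ?thesis .
  qed (simp add: mult_ext)
qed

lemma emb_in: "emb g \<in> carrier RG"
proof -
  have "supp (emb g) \<subseteq> {g}" by (auto simp: group_ring_emb_def split: if_splits)
  then have "finite (supp (emb g))" by (rule finite_subset) simp
  then show ?thesis by (auto simp: group_ring_emb_def)
qed

lemma emb_mult_apply:
  assumes "g \<in> carrier G" "b \<in> carrier RG" "x \<in> carrier G"
  shows "(emb g \<otimes>\<^bsub>RG\<^esub> b) x = b (inv\<^bsub>G\<^esub> g \<otimes>\<^bsub>G\<^esub> x)"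
proof -
  have "(emb g \<otimes>\<^bsub>RG\<^esub> b) x = (\<Oplus>\<^bsub>R\<^esub>y\<in>{g}. emb g y \<otimes>\<^bsub>R\<^esub> b (inv\<^bsub>G\<^esub> y \<otimes>\<^bsub>G\<^esub> x))"
    by (rule mult_apply[OF emb_in assms(2)])
       (use assms in \<open>auto simp: group_ring_emb_def split: if_splits\<close>)
  then show ?thesis using assms in_R[OF assms(2)] by (simp add: group_ring_emb_def)
qed

lemma mult_emb_apply:
  assumes "g \<in> carrier G" "a \<in> carrier RG" "x \<in> carrier G"
  shows "(a \<otimes>\<^bsub>RG\<^esub> emb g) x = a (x \<otimes>\<^bsub>G\<^esub> inv\<^bsub>G\<^esub> g)"
proof -
  let ?h = "x \<otimes>\<^bsub>G\<^esub> inv\<^bsub>G\<^esub> g"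
  have h: "?h \<in> carrier G" using assms by simp
  have *: "(inv\<^bsub>G\<^esub> y \<otimes>\<^bsub>G\<^esub> x = g) = (y = ?h)" if "y \<in> carrier G" for y
    using that assms by (metis G.inv_closed G.inv_solve_left G.inv_solve_right)
  have "(a \<otimes>\<^bsub>RG\<^esub> emb g) x = (\<Oplus>\<^bsub>R\<^esub>y\<in>insert ?h (supp a). a y \<otimes>\<^bsub>R\<^esub> emb g (inv\<^bsub>G\<^esub> y \<otimes>\<^bsub>G\<^esub> x))"
    by (rule mult_apply[OF assms(2) emb_in]) (use assms h in auto)
  also have "\<dots> = (\<Oplus>\<^bsub>R\<^esub>y\<in>insert ?h (supp a). if ?h = y then a y else \<zero>\<^bsub>R\<^esub>)"
  proof (intro R.finsum_cong' refl)
    fix y assume "y \<in> insert ?h (supp a)"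
    then have y: "y \<in> carrier G" using h by auto
    show "a y \<otimes>\<^bsub>R\<^esub> emb g (inv\<^bsub>G\<^esub> y \<otimes>\<^bsub>G\<^esub> x) = (if ?h = y then a y else \<zero>\<^bsub>R\<^esub>)"
      unfolding group_ring_emb_def using *[OF y] y in_R[OF assms(2) y] assms(3) by auto
  qed (use in_R[OF assms(2)] h in auto)
  also have "\<dots> = a ?h"
    using in_R[OF assms(2)] h assms(2) by (intro R.finsum_singleton) auto
  finally show ?thesis .
qed

lemma group_ring_ext: assumes "a \<in> carrier RG" "b \<in> carrier RG" "\<And>x. x \<in> carrier G \<Longrightarrow> a x = b x" shows "a = b"
  using assms by (auto intro!: extensionalityI[of _ "carrier G"] simp: PiE_def)

lemma add_closed:
  assumes "a \<in> carrier RG" "b \<in> carrier RG" shows "a \<oplus>\<^bsub>RG\<^esub> b \<in> carrier RG"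
proof -
  have "supp (a \<oplus>\<^bsub>RG\<^esub> b) \<subseteq> supp a \<union> supp b" by auto
  then have "finite (supp (a \<oplus>\<^bsub>RG\<^esub> b))" by (rule finite_subset) (use assms in auto)
  then show ?thesis using assms by auto
qed

lemma ring_RG: "ring RG"
proof (rule ringI)
  show "abelian_group RG"
  proof (rule abelian_groupI)
    show "\<zero>\<^bsub>RG\<^esub> \<in> carrier RG" by simp
    fix x assume x: "x \<in> carrier RG"
    show "\<zero>\<^bsub>RG\<^esub> \<oplus>\<^bsub>RG\<^esub> x = x"
    proof (rule group_ring_ext)
      have z: "\<zero>\<^bsub>RG\<^esub> \<in> carrier RG" by simp
      show "\<zero>\<^bsub>RG\<^esub> \<oplus>\<^bsub>RG\<^esub> x \<in> carrier RG" by (rule add_closed[OF z x])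
    qed (use x in_R[OF x] in auto)
    let ?y = "\<lambda>g\<in>carrier G. \<ominus>\<^bsub>R\<^esub> x g"
    have "supp ?y \<subseteq> supp x" by auto
    then have "finite (supp ?y)" by (rule finite_subset) (use x in auto)
    then have y: "?y \<in> carrier RG" using in_R[OF x] by auto
    moreover have "?y \<oplus>\<^bsub>RG\<^esub> x = \<zero>\<^bsub>RG\<^esub>"
      using in_R[OF x] by (auto simp: R.l_neg)
    ultimately show "\<exists>y\<in>carrier RG. y \<oplus>\<^bsub>RG\<^esub> x = \<zero>\<^bsub>RG\<^esub>" by blast
    fix y assume y: "y \<in> carrier RG"
    show "x \<oplus>\<^bsub>RG\<^esub> y = y \<oplus>\<^bsub>RG\<^esub> x" using in_R[OF x] in_R[OF y] by (auto simp: R.add.m_comm)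
    fix z assume z: "z \<in> carrier RG"
    show "x \<oplus>\<^bsub>RG\<^esub> y \<oplus>\<^bsub>RG\<^esub> z = x \<oplus>\<^bsub>RG\<^esub> (y \<oplus>\<^bsub>RG\<^esub> z)"
      using in_R[OF x] in_R[OF y] in_R[OF z] by (auto simp: R.add.m_assoc)
  qed (rule add_closed)
  show "monoid RG"
  proof (rule monoidI)
    show "\<one>\<^bsub>RG\<^esub> \<in> carrier RG" using emb_in by simp
    fix x assume x: "x \<in> carrier RG"
    have e: "emb \<one>\<^bsub>G\<^esub> \<otimes>\<^bsub>RG\<^esub> x = x"
      using emb_mult_apply[OF _ x] by (intro group_ring_ext mult_closed emb_in x) simp
    have e': "x \<otimes>\<^bsub>RG\<^esub> emb \<one>\<^bsub>G\<^esub> = x"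
      using mult_emb_apply[OF _ x] by (intro group_ring_ext mult_closed emb_in x) simp
    show "\<one>\<^bsub>RG\<^esub> \<otimes>\<^bsub>RG\<^esub> x = x" "x \<otimes>\<^bsub>RG\<^esub> \<one>\<^bsub>RG\<^esub> = x" using e e' by simp_all
  qed (rule mult_closed mult_assoc; assumption)+
  fix a b c assume abc: "a \<in> carrier RG" "b \<in> carrier RG" "c \<in> carrier RG"
  note ca = in_R[OF abc(1)] and cb = in_R[OF abc(2)] and cc = in_R[OF abc(3)]
  have ab: "a \<oplus>\<^bsub>RG\<^esub> b \<in> carrier RG" using abc add_closed by blast
  let ?S = "supp a \<union> supp b"
  have fS: "finite ?S" using abc by auto
  show "(a \<oplus>\<^bsub>RG\<^esub> b) \<otimes>\<^bsub>RG\<^esub> c = a \<otimes>\<^bsub>RG\<^esub> c \<oplus>\<^bsub>RG\<^esub> b \<otimes>\<^bsub>RG\<^esub> c"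
  proof (rule group_ring_ext)
    fix x assume x: "x \<in> carrier G"
    have k: "c (inv\<^bsub>G\<^esub> y \<otimes>\<^bsub>G\<^esub> x) \<in> carrier R" if "y \<in> carrier G" for y using that x cc by simp
    have "((a \<oplus>\<^bsub>RG\<^esub> b) \<otimes>\<^bsub>RG\<^esub> c) x = (\<Oplus>\<^bsub>R\<^esub>y\<in>?S. (a \<oplus>\<^bsub>RG\<^esub> b) y \<otimes>\<^bsub>R\<^esub> c (inv\<^bsub>G\<^esub> y \<otimes>\<^bsub>G\<^esub> x))"
      by (rule mult_apply[OF ab abc(3) fS _ _ x]) auto
    also have "\<dots> = (\<Oplus>\<^bsub>R\<^esub>y\<in>?S. a y \<otimes>\<^bsub>R\<^esub> c (inv\<^bsub>G\<^esub> y \<otimes>\<^bsub>G\<^esub> x) \<oplus>\<^bsub>R\<^esub> b y \<otimes>\<^bsub>R\<^esub> c (inv\<^bsub>G\<^esub> y \<otimes>\<^bsub>G\<^esub> x))"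
      using ca cb k by (intro R.finsum_cong' refl) (auto simp: R.l_distr)
    also have "\<dots> = (\<Oplus>\<^bsub>R\<^esub>y\<in>?S. a y \<otimes>\<^bsub>R\<^esub> c (inv\<^bsub>G\<^esub> y \<otimes>\<^bsub>G\<^esub> x)) \<oplus>\<^bsub>R\<^esub> (\<Oplus>\<^bsub>R\<^esub>y\<in>?S. b y \<otimes>\<^bsub>R\<^esub> c (inv\<^bsub>G\<^esub> y \<otimes>\<^bsub>G\<^esub> x))"
      using ca cb k by (intro R.finsum_addf) auto
    also have "(\<Oplus>\<^bsub>R\<^esub>y\<in>?S. a y \<otimes>\<^bsub>R\<^esub> c (inv\<^bsub>G\<^esub> y \<otimes>\<^bsub>G\<^esub> x)) = (a \<otimes>\<^bsub>RG\<^esub> c) x"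
      by (rule mult_apply[OF abc(1,3) fS _ _ x, symmetric]) auto
    also have "(\<Oplus>\<^bsub>R\<^esub>y\<in>?S. b y \<otimes>\<^bsub>R\<^esub> c (inv\<^bsub>G\<^esub> y \<otimes>\<^bsub>G\<^esub> x)) = (b \<otimes>\<^bsub>RG\<^esub> c) x"
      by (rule mult_apply[OF abc(2,3) fS _ _ x, symmetric]) auto
    finally show "((a \<oplus>\<^bsub>RG\<^esub> b) \<otimes>\<^bsub>RG\<^esub> c) x = (a \<otimes>\<^bsub>RG\<^esub> c \<oplus>\<^bsub>RG\<^esub> b \<otimes>\<^bsub>RG\<^esub> c) x"
      using x by (simp cong: restrict_cong add: group_ring_simps(4)[of R G "a \<otimes>\<^bsub>RG\<^esub> c"] del: group_ring_simps(4))
  qed (use abc ab add_closed mult_closed in blast)+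
  show "c \<otimes>\<^bsub>RG\<^esub> (a \<oplus>\<^bsub>RG\<^esub> b) = c \<otimes>\<^bsub>RG\<^esub> a \<oplus>\<^bsub>RG\<^esub> c \<otimes>\<^bsub>RG\<^esub> b"
  proof (rule group_ring_ext)
    fix x assume x: "x \<in> carrier G"
    have k: "a (inv\<^bsub>G\<^esub> y \<otimes>\<^bsub>G\<^esub> x) \<in> carrier R" "b (inv\<^bsub>G\<^esub> y \<otimes>\<^bsub>G\<^esub> x) \<in> carrier R" if "y \<in> carrier G" for y
      using that x ca cb by simp_all
    have "(c \<otimes>\<^bsub>RG\<^esub> (a \<oplus>\<^bsub>RG\<^esub> b)) x = (\<Oplus>\<^bsub>R\<^esub>y\<in>supp c. c y \<otimes>\<^bsub>R\<^esub> (a \<oplus>\<^bsub>RG\<^esub> b) (inv\<^bsub>G\<^esub> y \<otimes>\<^bsub>G\<^esub> x))"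
      by (rule mult_apply[OF abc(3) ab _ _ _ x]) (use abc in auto)
    also have "\<dots> = (\<Oplus>\<^bsub>R\<^esub>y\<in>supp c. c y \<otimes>\<^bsub>R\<^esub> a (inv\<^bsub>G\<^esub> y \<otimes>\<^bsub>G\<^esub> x) \<oplus>\<^bsub>R\<^esub> c y \<otimes>\<^bsub>R\<^esub> b (inv\<^bsub>G\<^esub> y \<otimes>\<^bsub>G\<^esub> x))"
      using cc k x by (intro R.finsum_cong' refl) (auto simp: R.r_distr)
    also have "\<dots> = (\<Oplus>\<^bsub>R\<^esub>y\<in>supp c. c y \<otimes>\<^bsub>R\<^esub> a (inv\<^bsub>G\<^esub> y \<otimes>\<^bsub>G\<^esub> x)) \<oplus>\<^bsub>R\<^esub> (\<Oplus>\<^bsub>R\<^esub>y\<in>supp c. c y \<otimes>\<^bsub>R\<^esub> b (inv\<^bsub>G\<^esub> y \<otimes>\<^bsub>G\<^esub> x))"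
      using cc k by (intro R.finsum_addf) auto
    also have "\<dots> = (c \<otimes>\<^bsub>RG\<^esub> a \<oplus>\<^bsub>RG\<^esub> c \<otimes>\<^bsub>RG\<^esub> b) x"
      using x by (simp add: group_ring_def)
    finally show "(c \<otimes>\<^bsub>RG\<^esub> (a \<oplus>\<^bsub>RG\<^esub> b)) x = (c \<otimes>\<^bsub>RG\<^esub> a \<oplus>\<^bsub>RG\<^esub> c \<otimes>\<^bsub>RG\<^esub> b) x" .
  qed (use abc ab add_closed mult_closed in blast)+
qed

lemma emb_mult:
  assumes "g \<in> carrier G" "h \<in> carrier G"
  shows "emb (g \<otimes>\<^bsub>G\<^esub> h) = emb g \<otimes>\<^bsub>RG\<^esub> emb h"
proof (rule group_ring_ext)
  fix x assume x: "x \<in> carrier G"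
  have "(inv\<^bsub>G\<^esub> g \<otimes>\<^bsub>G\<^esub> x = h) = (x = g \<otimes>\<^bsub>G\<^esub> h)"
    using x assms by (metis G.inv_closed G.inv_solve_left)
  then show "emb (g \<otimes>\<^bsub>G\<^esub> h) x = (emb g \<otimes>\<^bsub>RG\<^esub> emb h) x"
    using emb_mult_apply[OF assms(1) emb_in x] x assms by (simp add: group_ring_emb_def)
qed (use emb_in mult_closed in blast)+

lemma emb_hom: "emb \<in> hom G (units_of RG)"
proof -
  have "emb g \<in> Units RG" if g: "g \<in> carrier G" for g
    using emb_mult[of g "inv\<^bsub>G\<^esub> g"] emb_mult[of "inv\<^bsub>G\<^esub> g" g] g emb_in
    unfolding Units_def by (auto simp del: group_ring_simps(1) intro!: bexI[of _ "emb (inv\<^bsub>G\<^esub> g)"])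
  then show ?thesis using emb_mult by (auto simp: hom_def units_of_def)
qed

lemma emb_inj: "\<one>\<^bsub>R\<^esub> \<noteq> \<zero>\<^bsub>R\<^esub> \<Longrightarrow> inj_on emb (carrier G)"
  unfolding inj_on_def
proof (intro ballI impI)
  fix g h assume *: "\<one>\<^bsub>R\<^esub> \<noteq> \<zero>\<^bsub>R\<^esub>" "g \<in> carrier G" "h \<in> carrier G" "emb g = emb h"
  have "emb h g = \<one>\<^bsub>R\<^esub>"
    unfolding \<open>emb g = emb h\<close>[symmetric] using *(2) by (simp add: group_ring_emb_def)
  then show "g = h"
    using *(1,2) by (simp add: group_ring_emb_def split: if_splits)
qed

end

text \<open>
  The library's \<^const>\<open>normalizer\<close> is phrased with \<open>x H x\<inverse>\<close>; it is the same set as the one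
  defined by \<open>x\<inverse> H x = H\<close>.
\<close>

lemma normalizer_eq_conj:
  assumes "Y \<subseteq> carrier K" "group K"
  shows "normalizer K Y = {x \<in> carrier K. (\<lambda>h. inv\<^bsub>K\<^esub> x \<otimes>\<^bsub>K\<^esub> h \<otimes>\<^bsub>K\<^esub> x) ` Y = Y}"
proof -
  interpret K: group K by fact
  have s: "h \<in> Y \<Longrightarrow> h \<in> carrier K" for h using assms by auto
  have 1: "x <#\<^bsub>K\<^esub> Y #>\<^bsub>K\<^esub> inv\<^bsub>K\<^esub> x = (\<lambda>h. x \<otimes>\<^bsub>K\<^esub> h \<otimes>\<^bsub>K\<^esub> inv\<^bsub>K\<^esub> x) ` Y" for x
    by (auto simp: l_coset_def r_coset_def)
  have 2: "(\<lambda>h. inv\<^bsub>K\<^esub> x \<otimes>\<^bsub>K\<^esub> h \<otimes>\<^bsub>K\<^esub> x) ` (\<lambda>h. x \<otimes>\<^bsub>K\<^esub> h \<otimes>\<^bsub>K\<^esub> inv\<^bsub>K\<^esub> x) ` Y = Y" if "x \<in> carrier K" for x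
  proof -
    have "inv\<^bsub>K\<^esub> x \<otimes>\<^bsub>K\<^esub> (x \<otimes>\<^bsub>K\<^esub> h \<otimes>\<^bsub>K\<^esub> inv\<^bsub>K\<^esub> x) \<otimes>\<^bsub>K\<^esub> x = h" if h: "h \<in> Y" for h
      using s[OF h] \<open>x \<in> carrier K\<close> by (metis K.inv_closed K.inv_solve_left K.inv_solve_right K.m_assoc K.m_closed)
    then show ?thesis by (force simp: image_image)
  qed
  have 3: "(\<lambda>h. x \<otimes>\<^bsub>K\<^esub> h \<otimes>\<^bsub>K\<^esub> inv\<^bsub>K\<^esub> x) ` (\<lambda>h. inv\<^bsub>K\<^esub> x \<otimes>\<^bsub>K\<^esub> h \<otimes>\<^bsub>K\<^esub> x) ` Y = Y" if "x \<in> carrier K" for x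
    using 2[of "inv\<^bsub>K\<^esub> x"] that by simp
  have "(\<lambda>h. x \<otimes>\<^bsub>K\<^esub> h \<otimes>\<^bsub>K\<^esub> inv\<^bsub>K\<^esub> x) ` Y = Y \<longleftrightarrow> (\<lambda>h. inv\<^bsub>K\<^esub> x \<otimes>\<^bsub>K\<^esub> h \<otimes>\<^bsub>K\<^esub> x) ` Y = Y"
    if "x \<in> carrier K" for x
    proof
    assume "(\<lambda>h. x \<otimes>\<^bsub>K\<^esub> h \<otimes>\<^bsub>K\<^esub> inv\<^bsub>K\<^esub> x) ` Y = Y"
    then show "(\<lambda>h. inv\<^bsub>K\<^esub> x \<otimes>\<^bsub>K\<^esub> h \<otimes>\<^bsub>K\<^esub> x) ` Y = Y" using 2[OF that] by simp
  next
    assume "(\<lambda>h. inv\<^bsub>K\<^esub> x \<otimes>\<^bsub>K\<^esub> h \<otimes>\<^bsub>K\<^esub> x) ` Y = Y"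
    then show "(\<lambda>h. x \<otimes>\<^bsub>K\<^esub> h \<otimes>\<^bsub>K\<^esub> inv\<^bsub>K\<^esub> x) ` Y = Y" using 3[OF that] by simp
  qed
  then show ?thesis
    unfolding normalizer_def stabilizer_def using assms(1) by (auto simp: 1)
qed

end

theory Submission
  imports Defs
begin

text \<open>
  The heart of the matter is that two elements \<open>h\<close> and \<open>k\<close> of \<open>G\<close> which are conjugate under a unit
  of \<open>RG\<close> are already conjugate in \<open>G\<close>. To see this, let \<open>C\<close> be the conjugacy class of \<open>h\<close> and let
  \<open>\<tau>(a)\<close> be the sum of the coefficients of \<open>a\<close> on \<open>C\<close>. Since \<open>yz \<in> C\<close> if and only if \<open>zy \<in> C\<close>, and
  since \<open>R\<close> is commutative, \<open>\<tau>(ab) = \<tau>(ba)\<close>. So \<open>\<tau>\<close> takes the same value on \<open>h\<close> and on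
  \<open>k = u\<inverse>hu\<close>; this value is \<open>1 \<noteq> 0\<close>, and hence \<open>k \<in> C\<close>.

  The rest is group theory. If the unit \<open>u\<close> normalizes \<open>H = \<langle>h\<rangle>\<close>, then \<open>u\<inverse>hu = g\<inverse>hg\<close> for some
  \<open>g \<in> G\<close> by the first part. Since \<open>h\<close> generates \<open>H\<close>, conjugation by \<open>g\<close> and by \<open>u\<close> agree on all of
  \<open>H\<close>, so that \<open>g\<close> normalizes \<open>H\<close> and \<open>g\<inverse>u\<close> centralizes \<open>H\<close>. Cyclicity is essential here: for a
  general \<open>H\<close> the element \<open>g\<close> would depend on the element of \<open>H\<close> that is being conjugated.
\<close>

section \<open>Sums of coefficients over a conjugacy class\<close>

context group_ring_setting
begin

definition class_sum :: "'g set \<Rightarrow> ('g \<Rightarrow> 'r) \<Rightarrow> 'r"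
  where "class_sum C a = (\<Oplus>\<^bsub>R\<^esub>x\<in>supp a. if x \<in> C then a x else \<zero>\<^bsub>R\<^esub>)"

lemma class_sum_superset:
  assumes "a \<in> carrier RG" "finite S" "supp a \<subseteq> S" "S \<subseteq> carrier G"
  shows "class_sum C a = (\<Oplus>\<^bsub>R\<^esub>x\<in>S. if x \<in> C then a x else \<zero>\<^bsub>R\<^esub>)"
  unfolding class_sum_def
proof (rule R.add.finprod_mono_neutral_cong_left)
  show "(\<lambda>x. if x \<in> C then a x else \<zero>\<^bsub>R\<^esub>) \<in> S \<rightarrow> carrier R"
    using in_R[OF assms(1)] assms(4) by auto
qed (use assms in auto)

text \<open>
  Expanding the convolution product turns the class sum of \<open>a b\<close> into a double sum whose only
  asymmetry between \<open>a\<close> and \<open>b\<close> is the order of the factors in the condition \<open>y z \<in> C\<close>.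
\<close>

lemma class_sum_mult:
  assumes a: "a \<in> carrier RG" and b: "b \<in> carrier RG"
  shows "class_sum C (a \<otimes>\<^bsub>RG\<^esub> b) =
    (\<Oplus>\<^bsub>R\<^esub>y\<in>supp a. \<Oplus>\<^bsub>R\<^esub>z\<in>supp b. if y \<otimes>\<^bsub>G\<^esub> z \<in> C then a y \<otimes>\<^bsub>R\<^esub> b z else \<zero>\<^bsub>R\<^esub>)"
proof -
  define S where "S = (\<lambda>(y, z). y \<otimes>\<^bsub>G\<^esub> z) ` (supp a \<times> supp b)"
  have S: "finite S" "S \<subseteq> carrier G" "supp (a \<otimes>\<^bsub>RG\<^esub> b) \<subseteq> S"
    using a b supp_mult[OF a b] by (auto simp: S_def)
  have fin: "finite (supp a)" "finite (supp b)" using a b by auto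
  note ca = in_R[OF a] and cb = in_R[OF b]
  let ?f = "\<lambda>x y. if x \<in> C then a y \<otimes>\<^bsub>R\<^esub> b (inv\<^bsub>G\<^esub> y \<otimes>\<^bsub>G\<^esub> x) else \<zero>\<^bsub>R\<^esub>"
  have cf: "?f x y \<in> carrier R" if "x \<in> S" "y \<in> supp a" for x y
    using that S(2) ca cb by (auto intro!: R.m_closed)
  have "class_sum C (a \<otimes>\<^bsub>RG\<^esub> b) = (\<Oplus>\<^bsub>R\<^esub>x\<in>S. if x \<in> C then (a \<otimes>\<^bsub>RG\<^esub> b) x else \<zero>\<^bsub>R\<^esub>)"
    by (rule class_sum_superset[OF mult_closed[OF a b] S(1,3,2)])
  also have "\<dots> = (\<Oplus>\<^bsub>R\<^esub>x\<in>S. \<Oplus>\<^bsub>R\<^esub>y\<in>supp a. ?f x y)"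
  proof (intro R.finsum_cong' refl)
    fix x assume x: "x \<in> S"
    then have "(a \<otimes>\<^bsub>RG\<^esub> b) x = (\<Oplus>\<^bsub>R\<^esub>y\<in>supp a. a y \<otimes>\<^bsub>R\<^esub> b (inv\<^bsub>G\<^esub> y \<otimes>\<^bsub>G\<^esub> x))"
      using S(2) by (intro mult_apply[OF a b fin(1)]) auto
    then show "(if x \<in> C then (a \<otimes>\<^bsub>RG\<^esub> b) x else \<zero>\<^bsub>R\<^esub>) = (\<Oplus>\<^bsub>R\<^esub>y\<in>supp a. ?f x y)"
      by (cases "x \<in> C") (simp_all only: if_True if_False R.finsum_zero)
  qed (use cf in \<open>auto intro!: R.finsum_closed\<close>)
  also have "\<dots> = (\<Oplus>\<^bsub>R\<^esub>y\<in>supp a. \<Oplus>\<^bsub>R\<^esub>x\<in>S. ?f x y)"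
    by (rule finsum_swap[OF S(1) fin(1) cf])
  also have "\<dots> = (\<Oplus>\<^bsub>R\<^esub>y\<in>supp a. \<Oplus>\<^bsub>R\<^esub>z\<in>supp b. if y \<otimes>\<^bsub>G\<^esub> z \<in> C then a y \<otimes>\<^bsub>R\<^esub> b z else \<zero>\<^bsub>R\<^esub>)"
  proof (rule R.finsum_cong'[OF refl])
    fix y assume y: "y \<in> supp a"
    then have yG: "y \<in> carrier G" by simp
    \<comment> \<open>Substitute \<open>x = y z\<close>; the terms with \<open>y\<inverse> x\<close> outside the support of \<open>b\<close> vanish.\<close>
    let ?T = "(\<lambda>z. y \<otimes>\<^bsub>G\<^esub> z) ` supp b"
    have TS: "?T \<subseteq> S" using y by (auto simp: S_def)
    have cancel: "inv\<^bsub>G\<^esub> y \<otimes>\<^bsub>G\<^esub> (y \<otimes>\<^bsub>G\<^esub> z) = z" "y \<otimes>\<^bsub>G\<^esub> (inv\<^bsub>G\<^esub> y \<otimes>\<^bsub>G\<^esub> z) = z"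
      if "z \<in> carrier G" for z
      using that yG by (simp_all add: G.m_assoc[symmetric])
    have outside: "?f x y = \<zero>\<^bsub>R\<^esub>" if x: "x \<in> S - ?T" for x
    proof -
      have xG: "x \<in> carrier G" using x S(2) by auto
      have "inv\<^bsub>G\<^esub> y \<otimes>\<^bsub>G\<^esub> x \<notin> supp b"
      proof
        assume "inv\<^bsub>G\<^esub> y \<otimes>\<^bsub>G\<^esub> x \<in> supp b"
        then have "y \<otimes>\<^bsub>G\<^esub> (inv\<^bsub>G\<^esub> y \<otimes>\<^bsub>G\<^esub> x) \<in> ?T" by (rule imageI)
        then show False using x cancel(2)[OF xG] by simp
      qed
      then have "b (inv\<^bsub>G\<^esub> y \<otimes>\<^bsub>G\<^esub> x) = \<zero>\<^bsub>R\<^esub>"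
        using xG yG by simp
      then show ?thesis using ca[OF yG] by simp
    qed
    have "(\<Oplus>\<^bsub>R\<^esub>x\<in>S. ?f x y) = (\<Oplus>\<^bsub>R\<^esub>x\<in>?T. ?f x y)"
      by (rule R.add.finprod_mono_neutral_cong_right[OF S(1) TS outside])
        (use cf[OF _ y] in auto)
    also have "\<dots> = (\<Oplus>\<^bsub>R\<^esub>z\<in>supp b. ?f (y \<otimes>\<^bsub>G\<^esub> z) y)"
    proof (rule R.finsum_reindex)
      show "(\<lambda>x. ?f x y) \<in> ?T \<rightarrow> carrier R" using cf[OF _ y] TS by blast
      show "inj_on (\<lambda>z. y \<otimes>\<^bsub>G\<^esub> z) (supp b)" using yG by (auto intro!: inj_onI)
    qed
    also have "\<dots> = (\<Oplus>\<^bsub>R\<^esub>z\<in>supp b. if y \<otimes>\<^bsub>G\<^esub> z \<in> C then a y \<otimes>\<^bsub>R\<^esub> b z else \<zero>\<^bsub>R\<^esub>)"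
      using ca[OF yG] cb cancel(1) by (intro R.finsum_cong' refl) auto
    finally show "(\<Oplus>\<^bsub>R\<^esub>x\<in>S. ?f x y) =
      (\<Oplus>\<^bsub>R\<^esub>z\<in>supp b. if y \<otimes>\<^bsub>G\<^esub> z \<in> C then a y \<otimes>\<^bsub>R\<^esub> b z else \<zero>\<^bsub>R\<^esub>)" .
  qed (use ca cb in \<open>auto intro!: R.finsum_closed R.m_closed\<close>)
  finally show ?thesis .
qed

text \<open>
  The hypothesis on \<open>C\<close> says that \<open>C\<close> is closed under conjugation, because \<open>z y = y\<inverse> (y z) y\<close>.
\<close>

lemma class_sum_mult_commute:
  assumes a: "a \<in> carrier RG" and b: "b \<in> carrier RG"
    and C: "\<And>y z. y \<in> carrier G \<Longrightarrow> z \<in> carrier G \<Longrightarrow> y \<otimes>\<^bsub>G\<^esub> z \<in> C \<longleftrightarrow> z \<otimes>\<^bsub>G\<^esub> y \<in> C"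
  shows "class_sum C (a \<otimes>\<^bsub>RG\<^esub> b) = class_sum C (b \<otimes>\<^bsub>RG\<^esub> a)"
proof -
  note ca = in_R[OF a] and cb = in_R[OF b]
  have fin: "finite (supp a)" "finite (supp b)" using a b by auto
  have "class_sum C (a \<otimes>\<^bsub>RG\<^esub> b) =
    (\<Oplus>\<^bsub>R\<^esub>z\<in>supp b. \<Oplus>\<^bsub>R\<^esub>y\<in>supp a. if y \<otimes>\<^bsub>G\<^esub> z \<in> C then a y \<otimes>\<^bsub>R\<^esub> b z else \<zero>\<^bsub>R\<^esub>)"
    unfolding class_sum_mult[OF a b] by (rule finsum_swap[OF fin]) (use ca cb in auto)
  also have "\<dots> = (\<Oplus>\<^bsub>R\<^esub>z\<in>supp b. \<Oplus>\<^bsub>R\<^esub>y\<in>supp a. if z \<otimes>\<^bsub>G\<^esub> y \<in> C then b z \<otimes>\<^bsub>R\<^esub> a y else \<zero>\<^bsub>R\<^esub>)"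
    using ca cb C
    by (intro R.finsum_cong' refl) (auto simp: R.m_comm intro!: R.finsum_closed)
  also have "\<dots> = class_sum C (b \<otimes>\<^bsub>RG\<^esub> a)"
    by (rule class_sum_mult[OF b a, symmetric])
  finally show ?thesis .
qed

lemma class_sum_emb:
  assumes "g \<in> carrier G"
  shows "class_sum C (emb g) = (if g \<in> C then \<one>\<^bsub>R\<^esub> else \<zero>\<^bsub>R\<^esub>)"
proof -
  have "class_sum C (emb g) = (\<Oplus>\<^bsub>R\<^esub>x\<in>{g}. if x \<in> C then emb g x else \<zero>\<^bsub>R\<^esub>)"
    by (rule class_sum_superset[OF emb_in])
      (use assms in \<open>auto simp: group_ring_emb_def split: if_splits\<close>)
  then show ?thesis using assms by (simp add: group_ring_emb_def)
qed

text \<open>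
  The class sum over the conjugacy class of \<open>h\<close> separates \<open>h\<close> from all elements of \<open>G\<close> that are not
  conjugate to it, and cannot distinguish \<open>h = (h u) u\<inverse>\<close> from \<open>u\<inverse> (h u)\<close>.
\<close>

lemma conj_by_unit_imp_conj:
  assumes R: "\<one>\<^bsub>R\<^esub> \<noteq> \<zero>\<^bsub>R\<^esub>" and h: "h \<in> carrier G" and k: "k \<in> carrier G"
    and u: "u \<in> carrier (units_of RG)"
    and conj: "inv\<^bsub>units_of RG\<^esub> u \<otimes>\<^bsub>units_of RG\<^esub> emb h \<otimes>\<^bsub>units_of RG\<^esub> u = emb k"
  shows "\<exists>g\<in>carrier G. inv\<^bsub>G\<^esub> g \<otimes>\<^bsub>G\<^esub> h \<otimes>\<^bsub>G\<^esub> g = k"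
proof -
  interpret RG: ring RG by (rule ring_RG)
  interpret U: group "units_of RG" by (rule RG.units_group)
  define v where "v = inv\<^bsub>units_of RG\<^esub> u"
  have v: "v \<in> carrier (units_of RG)" using u by (simp add: v_def)
  have car: "x \<in> carrier RG" if "x \<in> carrier (units_of RG)" for x
    using that RG.Units_closed by (simp only: units_of_carrier)
  note uv = car[OF u] car[OF v]
  have vhu: "emb k = v \<otimes>\<^bsub>RG\<^esub> (emb h \<otimes>\<^bsub>RG\<^esub> u)"
    using conj mult_assoc[OF uv(2) emb_in uv(1)] by (simp only: v_def units_of_mult)
  have "u \<otimes>\<^bsub>units_of RG\<^esub> v = \<one>\<^bsub>units_of RG\<^esub>"
    unfolding v_def by (rule U.r_inv[OF u])
  then have uv1: "u \<otimes>\<^bsub>RG\<^esub> v = \<one>\<^bsub>RG\<^esub>"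
    by (simp only: units_of_mult units_of_one)
  have huv: "emb h \<otimes>\<^bsub>RG\<^esub> u \<otimes>\<^bsub>RG\<^esub> v = emb h"
    unfolding mult_assoc[OF emb_in uv] uv1 by (rule RG.r_one[OF emb_in])
  define C where "C = {inv\<^bsub>G\<^esub> g \<otimes>\<^bsub>G\<^esub> h \<otimes>\<^bsub>G\<^esub> g | g. g \<in> carrier G}"
  have C1: "z \<otimes>\<^bsub>G\<^esub> y \<in> C" if "y \<in> carrier G" "z \<in> carrier G" "y \<otimes>\<^bsub>G\<^esub> z \<in> C" for y z
  proof -
    obtain g where g: "g \<in> carrier G" "y \<otimes>\<^bsub>G\<^esub> z = inv\<^bsub>G\<^esub> g \<otimes>\<^bsub>G\<^esub> h \<otimes>\<^bsub>G\<^esub> g"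
      using \<open>y \<otimes>\<^bsub>G\<^esub> z \<in> C\<close> by (auto simp: C_def)
    have "z \<otimes>\<^bsub>G\<^esub> y = inv\<^bsub>G\<^esub> y \<otimes>\<^bsub>G\<^esub> (y \<otimes>\<^bsub>G\<^esub> z) \<otimes>\<^bsub>G\<^esub> y"
      using that by (simp add: G.m_assoc[symmetric])
    also have "\<dots> = inv\<^bsub>G\<^esub> (g \<otimes>\<^bsub>G\<^esub> y) \<otimes>\<^bsub>G\<^esub> h \<otimes>\<^bsub>G\<^esub> (g \<otimes>\<^bsub>G\<^esub> y)"
      unfolding g(2) using g(1) that(1) h by (simp add: G.inv_mult_group G.m_assoc)
    finally show ?thesis using g(1) that(1) by (auto simp: C_def)
  qed
  have "class_sum C (emb h) = class_sum C (emb k)"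
    using class_sum_mult_commute[OF mult_closed[OF emb_in uv(1)] uv(2), of C h] C1
    unfolding huv vhu by blast
  moreover have "h \<in> C"
    using h by (auto simp: C_def intro!: exI[of _ "\<one>\<^bsub>G\<^esub>"])
  ultimately have "k \<in> C"
    using R h k by (simp add: class_sum_emb split: if_splits)
  then show ?thesis by (auto simp: C_def)
qed

end

section \<open>Normalizers of embedded cyclic subgroups\<close>

text \<open>
  Conjugation is a homomorphism, so on the powers of \<open>h\<close> it is determined by its value on \<open>h\<close>.
\<close>

lemma conj_eq_on_cyclic:
  assumes "group_hom G K \<phi>" and H: "subgroup H G" and h: "h \<in> H"
    and gen: "H = range (\<lambda>n::int. h [^]\<^bsub>G\<^esub> n)"
    and u: "u \<in> carrier K" and w: "w \<in> carrier K"
    and eq: "inv\<^bsub>K\<^esub> u \<otimes>\<^bsub>K\<^esub> \<phi> h \<otimes>\<^bsub>K\<^esub> u = inv\<^bsub>K\<^esub> w \<otimes>\<^bsub>K\<^esub> \<phi> h \<otimes>\<^bsub>K\<^esub> w"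
    and x: "x \<in> H"
  shows "inv\<^bsub>K\<^esub> u \<otimes>\<^bsub>K\<^esub> \<phi> x \<otimes>\<^bsub>K\<^esub> u = inv\<^bsub>K\<^esub> w \<otimes>\<^bsub>K\<^esub> \<phi> x \<otimes>\<^bsub>K\<^esub> w"
proof -
  interpret \<phi>: group_hom G K \<phi> by fact
  have hG: "h \<in> carrier G" using subgroup.mem_carrier[OF H h] .
  obtain n :: int where n: "x = h [^]\<^bsub>G\<^esub> n" using x gen by auto
  have pow: "inv\<^bsub>K\<^esub> t \<otimes>\<^bsub>K\<^esub> \<phi> x \<otimes>\<^bsub>K\<^esub> t = (inv\<^bsub>K\<^esub> t \<otimes>\<^bsub>K\<^esub> \<phi> h \<otimes>\<^bsub>K\<^esub> t) [^]\<^bsub>K\<^esub> n"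
    if t: "t \<in> carrier K" for t
  proof -
    let ?c = "\<lambda>y. inv\<^bsub>K\<^esub> t \<otimes>\<^bsub>K\<^esub> y \<otimes>\<^bsub>K\<^esub> t"
    have cancel: "t \<otimes>\<^bsub>K\<^esub> (inv\<^bsub>K\<^esub> t \<otimes>\<^bsub>K\<^esub> y) = y" if "y \<in> carrier K" for y
      using that t by (simp add: \<phi>.H.m_assoc[symmetric])
    have "?c \<in> hom K K"
      using t by (intro homI) (simp_all add: \<phi>.H.m_assoc cancel)
    then have "?c (\<phi> h [^]\<^bsub>K\<^esub> n) = ?c (\<phi> h) [^]\<^bsub>K\<^esub> n"
      using hG by (intro hom_int_pow) auto
    then show ?thesis using hG by (simp add: n \<phi>.hom_int_pow)
  qed
  show ?thesis using pow[OF u] pow[OF w] eq by simp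
qed

text \<open>
  The hypothesis \<open>fusion\<close> says that elements of \<open>H\<close> which are conjugate in \<open>K\<close> are already
  conjugate in \<open>G\<close>. A single application, to a generator of \<open>H\<close>, yields the factor \<open>g\<close> of a
  normalizing element \<open>u\<close>, because \<open>g\<close> and \<open>u\<close> then act in the same way on all of \<open>H\<close>.
\<close>

lemma normalizer_image_cyclic:
  assumes \<phi>: "group_hom G K \<phi>" and inj: "inj_on \<phi> (carrier G)"
    and H: "subgroup H G" and cyc: "cyclic_group (G\<lparr>carrier := H\<rparr>)"
    and fusion: "\<And>h k u. h \<in> H \<Longrightarrow> k \<in> H \<Longrightarrow> u \<in> carrier K \<Longrightarrow>
      inv\<^bsub>K\<^esub> u \<otimes>\<^bsub>K\<^esub> \<phi> h \<otimes>\<^bsub>K\<^esub> u = \<phi> k \<Longrightarrow> \<exists>g\<in>carrier G. inv\<^bsub>G\<^esub> g \<otimes>\<^bsub>G\<^esub> h \<otimes>\<^bsub>G\<^esub> g = k"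
  shows "normalizer K (\<phi> ` H) = (\<phi> ` normalizer G H) <#>\<^bsub>K\<^esub> centralizer K (\<phi> ` H)"
proof -
  interpret \<phi>: group_hom G K \<phi> by fact
  have HG: "x \<in> carrier G" if "x \<in> H" for x using subgroup.mem_carrier[OF H that] .
  then have HG': "H \<subseteq> carrier G" by blast
  then have "\<phi> ` H \<subseteq> carrier K" by auto
  note norm_K = normalizer_eq_conj[OF this \<phi>.H.is_group]
    and norm_G = normalizer_eq_conj[OF HG' \<phi>.G.is_group]
  let ?cG = "\<lambda>g x. inv\<^bsub>G\<^esub> g \<otimes>\<^bsub>G\<^esub> x \<otimes>\<^bsub>G\<^esub> g" and ?cK = "\<lambda>u y. inv\<^bsub>K\<^esub> u \<otimes>\<^bsub>K\<^esub> y \<otimes>\<^bsub>K\<^esub> u"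
  have \<phi>_conj: "\<phi> (?cG g x) = ?cK (\<phi> g) (\<phi> x)" if "g \<in> carrier G" "x \<in> carrier G" for g x
    using that by simp
  interpret HH: group "G\<lparr>carrier := H\<rparr>"
    using H \<phi>.G.is_group by (rule subgroup.subgroup_is_group)
  obtain h where h: "h \<in> H" "H = range (\<lambda>n::int. h [^]\<^bsub>G\<lparr>carrier := H\<rparr>\<^esub> n)"
    using cyc unfolding HH.cyclic_group by auto
  have gen: "H = range (\<lambda>n::int. h [^]\<^bsub>G\<^esub> n)"
    using h(2) unfolding \<phi>.G.int_pow_consistent[OF H h(1), symmetric] .
  show ?thesis
  proof (intro equalityI subsetI)
    fix u assume "u \<in> normalizer K (\<phi> ` H)"
    then have u: "u \<in> carrier K" and uH: "?cK u ` \<phi> ` H = \<phi> ` H" by (auto simp: norm_K)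
    obtain k where k: "k \<in> H" "?cK u (\<phi> h) = \<phi> k" using uH h(1) by blast
    then obtain g where g: "g \<in> carrier G" "?cG g h = k" using fusion[OF h(1) k(1) u] by blast
    have gu: "?cK u (\<phi> x) = \<phi> (?cG g x)" if "x \<in> H" for x
    proof -
      have "?cK u (\<phi> h) = ?cK (\<phi> g) (\<phi> h)"
        using k(2) g \<phi>_conj[OF g(1) HG[OF h(1)]] by simp
      with g(1) have "?cK u (\<phi> x) = ?cK (\<phi> g) (\<phi> x)"
        by (intro conj_eq_on_cyclic[OF \<phi> H h(1) gen u _ _ that]) auto
      then show ?thesis using \<phi>_conj[OF g(1) HG[OF that]] by simp
    qed
    have "\<phi> ` (?cG g ` H) = ?cK u ` \<phi> ` H"
      unfolding image_image using gu by (intro image_cong) simp_all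
    then have "\<phi> ` (?cG g ` H) = \<phi> ` H" using uH by simp
    then have "?cG g ` H = H"
      by (subst (asm) inj_on_image_eq_iff[OF inj]) (use HG g(1) in auto)
    then have gN: "g \<in> normalizer G H" using g(1) by (simp add: norm_G)
    define c where "c = inv\<^bsub>K\<^esub> (\<phi> g) \<otimes>\<^bsub>K\<^esub> u"
    have c: "c \<in> carrier K" "u = \<phi> g \<otimes>\<^bsub>K\<^esub> c"
      using u g(1) by (simp_all add: c_def \<phi>.H.m_assoc[symmetric])
    have "c \<otimes>\<^bsub>K\<^esub> y = y \<otimes>\<^bsub>K\<^esub> c" if "y \<in> \<phi> ` H" for y
    proof -
      obtain x where x: "x \<in> H" "y = ?cK u (\<phi> x)" using uH \<open>y \<in> \<phi> ` H\<close> by blast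
      have xK: "\<phi> x \<in> carrier K" using HG[OF x(1)] by simp
      have yg: "y = ?cK (\<phi> g) (\<phi> x)"
        using x gu[OF x(1)] \<phi>_conj[OF g(1) HG[OF x(1)]] by simp
      have canc: "t \<otimes>\<^bsub>K\<^esub> (inv\<^bsub>K\<^esub> t \<otimes>\<^bsub>K\<^esub> z) = z" if "t \<in> carrier K" "z \<in> carrier K" for t z
        using that by (simp add: \<phi>.H.m_assoc[symmetric])
      have "c \<otimes>\<^bsub>K\<^esub> y = inv\<^bsub>K\<^esub> (\<phi> g) \<otimes>\<^bsub>K\<^esub> (\<phi> x \<otimes>\<^bsub>K\<^esub> u)"
        unfolding x(2) c_def using u g(1) xK by (simp add: \<phi>.H.m_assoc canc)
      also have "\<dots> = y \<otimes>\<^bsub>K\<^esub> c"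
        unfolding yg c_def using u g(1) xK by (simp add: \<phi>.H.m_assoc canc del: \<phi>.hom_inv)
      finally show ?thesis .
    qed
    then have "c \<in> centralizer K (\<phi> ` H)" using c(1) by (simp add: centralizer_def)
    then show "u \<in> (\<phi> ` normalizer G H) <#>\<^bsub>K\<^esub> centralizer K (\<phi> ` H)"
      using gN c(2) unfolding set_mult_def by blast
  next
    fix u assume "u \<in> (\<phi> ` normalizer G H) <#>\<^bsub>K\<^esub> centralizer K (\<phi> ` H)"
    then obtain g c where gN: "g \<in> normalizer G H" and cC: "c \<in> centralizer K (\<phi> ` H)"
      and u: "u = \<phi> g \<otimes>\<^bsub>K\<^esub> c" unfolding set_mult_def by blast
    have g: "g \<in> carrier G" "?cG g ` H = H" using gN by (auto simp: norm_G)
    have c: "c \<in> carrier K" "c \<otimes>\<^bsub>K\<^esub> \<phi> x = \<phi> x \<otimes>\<^bsub>K\<^esub> c" if "x \<in> H" for x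
      using cC that by (auto simp: centralizer_def)
    have cK: "c \<in> carrier K" using c(1)[OF h(1)] .
    have "?cK u (\<phi> x) = \<phi> (?cG g x)" if x: "x \<in> H" for x
    proof -
      have y: "?cG g x \<in> H" using g(2) x by blast
      have "?cK u (\<phi> x) = inv\<^bsub>K\<^esub> c \<otimes>\<^bsub>K\<^esub> (?cK (\<phi> g) (\<phi> x) \<otimes>\<^bsub>K\<^esub> c)"
        unfolding u using g(1) cK HG[OF x] by (simp add: \<phi>.H.inv_mult_group \<phi>.H.m_assoc)
      also have "\<dots> = inv\<^bsub>K\<^esub> c \<otimes>\<^bsub>K\<^esub> (c \<otimes>\<^bsub>K\<^esub> \<phi> (?cG g x))"
        using c(2)[OF y] \<phi>_conj[OF g(1) HG[OF x]] by simp
      also have "\<dots> = \<phi> (?cG g x)"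
        using cK HG[OF y] by (simp add: \<phi>.H.m_assoc[symmetric] del: \<phi>.hom_mult)
      finally show ?thesis .
    qed
    then have "?cK u ` \<phi> ` H = \<phi> ` (?cG g ` H)"
      unfolding image_image by (intro image_cong) simp_all
    then show "u \<in> normalizer K (\<phi> ` H)"
      using g cK by (simp add: norm_K u)
  qed
qed

theorem proposition5:
  fixes G :: "('g, 'm) monoid_scheme"
    and R :: "('r, 'n) ring_scheme"
    and H :: "'g set"
  assumes "group G"
    and "subgroup H G"
    and "cyclic_group (G\<lparr>carrier := H\<rparr>)"
    and "cring R"
    and "\<one>\<^bsub>R\<^esub> \<noteq> \<zero>\<^bsub>R\<^esub>"
  shows "normalizer (units_of (group_ring R G)) (group_ring_emb R G ` H) =
    (group_ring_emb R G ` normalizer G H)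
      <#>\<^bsub>units_of (group_ring R G)\<^esub>
    centralizer (units_of (group_ring R G)) (group_ring_emb R G ` H)"
proof -
  interpret group_ring_setting G R
    using assms(1,4) by (simp add: group_ring_setting_def)
  interpret RG: ring RG by (rule ring_RG)
  have "group_hom G (units_of RG) emb"
    using assms(1) RG.units_group emb_hom by (simp add: group_hom_def group_hom_axioms_def)
  then show ?thesis
  proof (rule normalizer_image_cyclic[OF _ emb_inj[OF assms(5)] assms(2,3)])
    fix h k u
    assume "h \<in> H" "k \<in> H" "u \<in> carrier (units_of RG)"
      "inv\<^bsub>units_of RG\<^esub> u \<otimes>\<^bsub>units_of RG\<^esub> emb h \<otimes>\<^bsub>units_of RG\<^esub> u = emb k"
    then show "\<exists>g\<in>carrier G. inv\<^bsub>G\<^esub> g \<otimes>\<^bsub>G\<^esub> h \<otimes>\<^bsub>G\<^esub> g = k"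
      using conj_by_unit_imp_conj[OF assms(5)] subgroup.mem_carrier[OF assms(2)] by blast
  qed
qed

end
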